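(* Let $\nu$ be a non-zero finite Borel measure on $(0,1)$. Then $$\underline s_\nu\le\underline h_\nu\le\underline{\dim}_M(\nu),$$ where $\underline{\dim}_M(\nu)$ is the lower Minkowski dimension of $\operatorname{supp}\nu$.
   Context: $\Lambda$ is Lebesgue measure; $\nu$ is regarded as a measure on $[0,1]$. A $\nu$-partition is a finite family $\{(c_k,c_{k+1}]:k=1,\dots,n-1\}$, $n\ge2$, with $0=c_1<c_2<\dots<c_n=1$ and $\nu(\{c_k\})=0$ for all $k$; $\Pi$ is the set of all $\nu$-partitions. $\mathcal N^R(x):=\inf\{\operatorname{card}P:P\in\Pi,\ \max_{C\in P}\nu(C)\Lambda(C)<1/x\}$ and $\underline h_\nu:=\liminf_{x\to\infty}\frac{\log\mathcal N^R(x)}{\log x}$. $H^1_0(0,1)$ is the space of functions $f:[0,1]\to\mathbb R$ with $f(x)=\int_{[0,x]}g\,d\Lambda$ for some $g\in L^2_\Lambda([0,1])$ and $f(0)=f(1)=0$; $\nabla_\Lambda f:=g$. $C_\nu([0,1])$ is the set of continuous real functions on $[0,1]$ that are affine linear on every connected component of $[0,1]\setminus\operatorname{supp}\nu$. $\operatorname{dom}(\mathcal E_\nu):=H^1_0(0,1)\cap C_\nu([0,1])$, $\mathcal E_\nu(f,g):=\int_{(0,1)}\nabla_\Lambda f\,\nabla_\Lambda g\,d\Lambda$. A number $\lambda$ is an eigenvalue of $\mathcal E_\nu$ if there is $f\in\operatorname{dom}(\mathcal E_\nu)\setminus\{0\}$ with $\mathcal E_\nu(f,g)=\lambda\int fg\,d\nu$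 for all $g\in\operatorname{dom}(\mathcal E_\nu)$. $N_\nu(x)$ is the number of eigenvalues $\le x$ (with multiplicity). $\underline{s}_\nu:=\liminf_{x\to\infty}\frac{\log N_\nu(x)}{\log x}$. *)

theory Defs
  imports "HOL-Analysis.Analysis" "HOL-Library.Function_Algebras"
begin

text \<open>
  A Borel measure on the open unit interval, regarded as a measure on the closed one, is represented
  by its extension by zero to the Borel sets of the real line: a measure \<open>\<nu>\<close> with
  \<open>sets \<nu> = sets borel\<close> and \<open>emeasure \<nu> (- {0<..<1}) = 0\<close>. A function on the closed unit interval
  is represented by its extension by zero to the real line, so that equality of functions on the
  interval is equality in HOL and the functions in question form a genuine real vector space.
\<close>

definition supp :: "'a::topological_space measure \<Rightarrow> 'a set" where
  "supp \<nu> = {x. \<forall>U. open U \<and> x \<in> U \<longrightarrow> emeasure \<nu> U > 0}"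


subsection \<open>Logarithmic growth exponents\<close>

definition elog :: "enat \<Rightarrow> ereal" where
  "elog m = (case m of enat n \<Rightarrow> if n = 0 then - \<infinity> else ereal (ln (real n)) | \<infinity> \<Rightarrow> \<infinity>)"

definition lower_exponent :: "(real \<Rightarrow> enat) \<Rightarrow> ereal" where
  "lower_exponent N = Liminf at_top (\<lambda>x. elog (N x) / ereal (ln x))"


subsection \<open>Partitions\<close>

definition nu_partitions :: "real measure \<Rightarrow> real set set set" where
  "nu_partitions \<nu> =
    {{{c k<..c (k + 1)} | k. k \<in> {1..n - 1}} | (c :: nat \<Rightarrow> real) n.
       n \<ge> 2 \<and> c 1 = 0 \<and> c n = 1 \<and> (\<forall>k\<in>{1..n - 1}. c k < c (k + 1)) \<and>
       (\<forall>k\<in>{1..n}. measure \<nu> {c k} = 0)}"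

definition partition_count :: "real measure \<Rightarrow> real \<Rightarrow> enat" where
  "partition_count \<nu> x =
    Inf {enat (card P) | P. P \<in> nu_partitions \<nu> \<and>
      Max ((\<lambda>C. measure \<nu> C * measure lborel C) ` P) < 1 / x}"

definition lower_h :: "real measure \<Rightarrow> ereal" where
  "lower_h \<nu> = lower_exponent (partition_count \<nu>)"


subsection \<open>The Dirichlet form\<close>

definition L2_unit :: "(real \<Rightarrow> real) set" where
  "L2_unit = {g. set_borel_measurable lborel {0..1} g \<and> set_integrable lborel {0..1} (\<lambda>x. (g x)\<^sup>2)}"

definition is_gradient :: "(real \<Rightarrow> real) \<Rightarrow> (real \<Rightarrow> real) \<Rightarrow> bool" where
  "is_gradient f g \<longleftrightarrow> g \<in> L2_unit \<and> (\<forall>x\<in>{0..1}. f x = (LINT t:{0..x}|lborel. g t))"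

definition H10 :: "(real \<Rightarrow> real) set" where
  "H10 = {f. (\<forall>x. x \<notin> {0..1} \<longrightarrow> f x = 0) \<and> (\<exists>g. is_gradient f g) \<and> f 0 = 0 \<and> f 1 = 0}"

text \<open>The gradient is determined only almost everywhere; the choice of representative does not
  affect the form below.\<close>

definition gradient :: "(real \<Rightarrow> real) \<Rightarrow> real \<Rightarrow> real" where
  "gradient f = (SOME g. is_gradient f g)"

definition C_nu :: "real measure \<Rightarrow> (real \<Rightarrow> real) set" where
  "C_nu \<nu> = {f. (\<forall>x. x \<notin> {0..1} \<longrightarrow> f x = 0) \<and> continuous_on {0..1} f \<and>
     (\<forall>I\<in>components ({0..1} - supp \<nu>). \<exists>a b. \<forall>x\<in>I. f x = a * x + b)}"

definition form_dom :: "real measure \<Rightarrow> (real \<Rightarrow> real) set" where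
  "form_dom \<nu> = H10 \<inter> C_nu \<nu>"

definition form :: "(real \<Rightarrow> real) \<Rightarrow> (real \<Rightarrow> real) \<Rightarrow> real" where
  "form f g = (LINT x:{0<..<1}|lborel. gradient f x * gradient g x)"


subsection \<open>Eigenvalues\<close>

interpretation fun_space: vector_space "\<lambda>(c::real) (f::real \<Rightarrow> real) x. c * f x"
  by unfold_locales (auto simp: fun_eq_iff algebra_simps)

text \<open>The library's \<open>dim\<close> is \<open>0\<close> on infinite-dimensional spaces.\<close>

definition edim :: "(real \<Rightarrow> real) set \<Rightarrow> enat" where
  "edim V = (if \<exists>B. finite B \<and> V \<subseteq> fun_space.span B then enat (fun_space.dim V) else \<infinity>)"

definition eigenspace :: "real measure \<Rightarrow> real \<Rightarrow> (real \<Rightarrow> real) set" where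
  "eigenspace \<nu> l = {f \<in> form_dom \<nu>. \<forall>g\<in>form_dom \<nu>. form f g = l * (LINT x|\<nu>. f x * g x)}"

definition eigenvalues :: "real measure \<Rightarrow> real set" where
  "eigenvalues \<nu> = {l. \<exists>f \<in> eigenspace \<nu> l. f \<noteq> (\<lambda>_. 0)}"

definition eigenvalue_count :: "real measure \<Rightarrow> real \<Rightarrow> enat" where
  "eigenvalue_count \<nu> x =
    (if finite {l \<in> eigenvalues \<nu>. l \<le> x}
     then \<Sum>l\<in>{l \<in> eigenvalues \<nu>. l \<le> x}. edim (eigenspace \<nu> l) else \<infinity>)"

definition lower_s :: "real measure \<Rightarrow> ereal" where
  "lower_s \<nu> = lower_exponent (eigenvalue_count \<nu>)"


subsection \<open>Lower Minkowski dimension\<close>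

definition covering_number :: "'a::metric_space set \<Rightarrow> real \<Rightarrow> enat" where
  "covering_number A r = Inf {enat (card S) | S. finite S \<and> A \<subseteq> (\<Union>c\<in>S. cball c r)}"

definition lower_minkowski_dim :: "'a::metric_space set \<Rightarrow> ereal" where
  "lower_minkowski_dim A =
    Liminf (at_right 0) (\<lambda>r. elog (covering_number A r) / ereal (- ln r))"

end

theory Submission
  imports Defs
begin

text \<open>
  If a partition \<open>P\<close> satisfies \<open>\<nu>(C) \<Lambda>(C) < 1 / x\<close> for all its cells and more than \<open>card P\<close> independent
  eigenfunctions had eigenvalues \<open>\<le> x\<close>, some nonzero combination \<open>f\<close> of them would vanish at the left
  endpoint of every cell. The Cauchy--Schwarz inequality on each cell gives
  \<open>\<integral> f\<^sup>2 d\<nu> < \<E>(f,f) / x\<close>, whereas \<open>\<E>(f,f) \<le> x \<integral> f\<^sup>2 d\<nu>\<close> since eigenspaces are orthogonal; hence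
  \<open>N\<^sub>\<nu>(x) \<le> N\<^sup>R(x)\<close>. For the second inequality, a cover of the support by \<open>N\<close> balls of radius \<open>r\<close> yields a
  \<open>\<nu>\<close>-partition with at most \<open>2 N + 1\<close> cells, each with \<open>\<nu>(C) \<Lambda>(C) \<le> 4 r \<nu>(\<real>)\<close>.
\<close>

subsection \<open>Gradients and the Dirichlet form\<close>

text \<open>Since \<open>ennreal\<close> truncates at 0, the densities \<open>1 * d\<close> and
  \<open>(-1) * d\<close> are the positive and the negative part of \<open>d\<close>. They define
  measures that agree on all rays, hence are equal; uniqueness of densities makes the two parts
  agree a.e., and one of them is always 0.\<close>

lemma AE_eq_0_if_integral_rays_eq_0:
  fixes d :: "real \<Rightarrow> real"
  assumes d: "integrable lborel d" and zero: "\<And>x. (LINT t:{x<..}|lborel. d t) = 0"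
  shows "AE x in lborel. d x = 0"
proof -
  have [measurable]: "d \<in> borel_measurable borel" using d by auto
  have int: "integrable lborel (\<lambda>t. indicator {x<..} t * d t)" for x
    using integrable_mult_indicator[OF _ d, of "{x<..}"] by simp
  have e: "emeasure (density lborel (\<lambda>t. ennreal (s * d t))) {x<..} =
      (\<integral>\<^sup>+t. ennreal (s * (indicator {x<..} t * d t)) \<partial>lborel)" for x s
    by (subst emeasure_density) (auto intro!: nn_integral_cong split: split_indicator)
  \<comment> \<open>Finiteness serves twice: measures are determined by rays only if these have
    finite measure, and \<open>enn2real\<close> may be undone only on finite values.\<close>
  have fin: "emeasure (density lborel (\<lambda>t. ennreal (s * d t))) {x<..} < top" for x s
    unfolding e using integrableD(2)[OF integrable_mult_right[OF int[of x], of s]]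
    by (auto simp: less_top)
  have "density lborel (\<lambda>t. ennreal (1 * d t)) = density lborel (\<lambda>t. ennreal ((-1) * d t))"
  proof (rule measure_eqI_lessThan)
    fix x
    have "enn2real (\<integral>\<^sup>+t. ennreal (1 * (indicator {x<..} t * d t)) \<partial>lborel) =
        enn2real (\<integral>\<^sup>+t. ennreal ((-1) * (indicator {x<..} t * d t)) \<partial>lborel)"
      using zero[of x] real_lebesgue_integral_def[OF int[of x]]
      by (simp add: set_lebesgue_integral_def)
    then show "emeasure (density lborel (\<lambda>t. ennreal (1 * d t))) {x<..} =
        emeasure (density lborel (\<lambda>t. ennreal ((-1) * d t))) {x<..}"
      using ennreal_enn2real[OF fin[of 1 x]] ennreal_enn2real[OF fin[of "-1" x]] unfolding e
      by metis
  qed (use fin[of 1] in auto)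
  then have "AE x in lborel. ennreal (1 * d x) = ennreal ((-1) * d x)"
    by (intro sigma_finite_measure.density_unique[OF sigma_finite_lborel]) auto
  then show ?thesis
    proof eventually_elim
    case (elim x)
    then show ?case by (cases "d x \<ge> 0") (auto simp: ennreal_neg ennreal_eq_0_iff)
  qed
qed

section \<open>Square-integrable functions and gradients on the unit interval\<close>

lemma L2_unit_mult:
  assumes "g \<in> L2_unit" "h \<in> L2_unit"
  shows "set_integrable lborel {0..1} (\<lambda>x. g x * h x)"
proof -
  have [measurable]: "(\<lambda>x. indicator {0..1} x *\<^sub>R g x) \<in> borel_measurable lborel"
    "(\<lambda>x. indicator {0..1} x *\<^sub>R h x) \<in> borel_measurable lborel"
    and i: "integrable lborel (\<lambda>x. indicator {0..1} x *\<^sub>R (g x)\<^sup>2)"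
      "integrable lborel (\<lambda>x. indicator {0..1} x *\<^sub>R (h x)\<^sup>2)"
    using assms by (auto simp: L2_unit_def set_borel_measurable_def set_integrable_def)
  show ?thesis unfolding set_integrable_def
  proof (rule Bochner_Integration.integrable_bound[OF Bochner_Integration.integrable_add[OF i]])
    \<comment> \<open>\<open>L2_unit\<close> provides measurability only after cutting off to the
      interval, so the product of the two cut-off functions is used.\<close>
    have "(\<lambda>x. (indicator {0..1} x *\<^sub>R g x) * (indicator {0..1} x *\<^sub>R h x)) \<in> borel_measurable lborel"
      by measurable
    moreover have "(\<lambda>x. (indicator {0..1} x *\<^sub>R g x) * (indicator {0..1} x *\<^sub>R h x)) =
        (\<lambda>x. indicator {0..1} x *\<^sub>R (g x * h x))"
      by (auto split: split_indicator)
    ultimately show "(\<lambda>x. indicator {0..1} x *\<^sub>R (g x * h x)) \<in> borel_measurable lborel" by metis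
    have "\<bar>a * b\<bar> \<le> a\<^sup>2 + b\<^sup>2" for a b :: real
      using sum_squares_bound[of "\<bar>a\<bar>" "\<bar>b\<bar>"] mult_nonneg_nonneg[of "\<bar>a\<bar>" "\<bar>b\<bar>"]
      by (simp add: abs_mult del: mult_nonneg_nonneg zero_le_mult_iff)
    then show "AE x in lborel. norm (indicator {0..1} x *\<^sub>R (g x * h x))
        \<le> norm (indicator {0..1} x *\<^sub>R (g x)\<^sup>2 + indicator {0..1} x *\<^sub>R (h x)\<^sup>2)"
      by (auto split: split_indicator)
  qed
qed

lemma one_in_L2_unit: "(\<lambda>_. 1) \<in> L2_unit"
  by (auto simp: L2_unit_def set_borel_measurable_def set_integrable_def)

lemma L2_unit_integrable: "g \<in> L2_unit \<Longrightarrow> set_integrable lborel {0..1} g"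
  using L2_unit_mult[OF _ one_in_L2_unit, of g] by simp

lemma L2_unit_lincomb:
  assumes "g \<in> L2_unit" "h \<in> L2_unit"
  shows "(\<lambda>x. a * g x + b * h x) \<in> L2_unit"
proof -
  have "set_borel_measurable lborel {0..1} (\<lambda>x. a * g x + b * h x)"
    using set_integral_add(1)[OF set_integrable_mult_right[OF L2_unit_integrable[OF assms(1)]]
      set_integrable_mult_right[OF L2_unit_integrable[OF assms(2)]], of a b]
    unfolding set_integrable_def set_borel_measurable_def by auto
  moreover have "(\<lambda>x. a\<^sup>2 * (g x * g x) + (2 * a * b) * (g x * h x) + b\<^sup>2 * (h x * h x)) =
      (\<lambda>x. (a * g x + b * h x)\<^sup>2)"
    by (simp add: fun_eq_iff power2_sum power_mult_distrib power2_eq_square[symmetric] mult_ac)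
  then have "set_integrable lborel {0..1} (\<lambda>x. (a * g x + b * h x)\<^sup>2)"
    using set_integral_add(1)[OF set_integral_add(1)[OF
      set_integrable_mult_right[OF L2_unit_mult[OF assms(1) assms(1)], of "a\<^sup>2"]
      set_integrable_mult_right[OF L2_unit_mult[OF assms(1) assms(2)], of "2 * a * b"]]
      set_integrable_mult_right[OF L2_unit_mult[OF assms(2) assms(2)], of "b\<^sup>2"]]
    by metis
  ultimately show ?thesis by (simp add: L2_unit_def)
qed

lemma is_gradient_lincomb:
  assumes "is_gradient f g" "is_gradient f' g'"
  shows "is_gradient (\<lambda>x. a * f x + b * f' x) (\<lambda>x. a * g x + b * g' x)"
proof -
  have L: "g \<in> L2_unit" "g' \<in> L2_unit" using assms by (auto simp: is_gradient_def)
  have "set_integrable lborel {0..x} g" "set_integrable lborel {0..x} g'" if "x \<in> {0..1}" for x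
    using L that by (auto intro: set_integrable_subset[OF L2_unit_integrable])
  then show ?thesis
    using assms L by (auto simp: is_gradient_def L2_unit_lincomb)
qed

text \<open>The difference of two gradients has integral 0 over every \<open>{0..x}\<close>. Cut off
  outside the interval, it then has integral 0 over every ray.\<close>

lemma is_gradient_unique_AE:
  assumes "is_gradient f g" "is_gradient f h"
  shows "AE x in lborel. x \<in> {0..1} \<longrightarrow> g x = h x"
proof -
  have L: "g \<in> L2_unit" "h \<in> L2_unit" using assms by (auto simp: is_gradient_def)
  define d where "d = (\<lambda>x. indicator {0..1} x *\<^sub>R (g x - h x))"
  have si: "set_integrable lborel {0..1} (\<lambda>x. g x - h x)"
    using L by (intro set_integral_diff(1) L2_unit_integrable)
  then have int: "integrable lborel d" by (simp add: d_def set_integrable_def)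
  have 0: "(LINT t:{0..x}|lborel. g t - h t) = 0" if "x \<in> {0..1}" for x
  proof -
    have "set_integrable lborel {0..x} g" "set_integrable lborel {0..x} h"
      using L that by (auto intro: set_integrable_subset[OF L2_unit_integrable])
    then show ?thesis using assms that by (auto simp: is_gradient_def)
  qed
  have "(LINT t:{x<..}|lborel. d t) = 0" for x
  proof -
    \<comment> \<open>Clamping \<open>x\<close> to the unit interval: the ray beyond
      \<open>x\<close> meets \<open>{0..1}\<close> in \<open>{y<..1}\<close>, up to the null point 0
      when \<open>x\<close> is negative.\<close>
    define y where "y = max 0 (min x 1)"
    have y: "y \<in> {0..1}" by (auto simp: y_def)
    have "(LINT t:{0..1}|lborel. g t - h t) = (LINT t:{0..y} \<union> {y<..1}|lborel. g t - h t)"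
      using y by (intro arg_cong[where f="\<lambda>A. set_lebesgue_integral lborel A _"]) auto
    also have "\<dots> = (LINT t:{0..y}|lborel. g t - h t) + (LINT t:{y<..1}|lborel. g t - h t)"
      using y by (intro set_integral_Un set_integrable_subset[OF si]) auto
    finally have "(LINT t:{y<..1}|lborel. g t - h t) = 0" using 0[of 1] 0[OF y] by simp
    moreover have "(LINT t:{x<..}|lborel. d t) = (LINT t:{y<..1}|lborel. g t - h t)"
      unfolding set_lebesgue_integral_def
    proof (rule integral_cong_AE)
      show "AE t in lborel. indicat_real {x<..} t *\<^sub>R d t = indicat_real {y<..1} t *\<^sub>R (g t - h t)"
        using AE_lborel_singleton[of 0]
        by eventually_elim (auto simp: d_def y_def split: split_indicator)
      have "set_integrable lborel {y<..1} (\<lambda>t. g t - h t)"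
        using y by (intro set_integrable_subset[OF si]) auto
      then show "(\<lambda>t. indicat_real {y<..1} t *\<^sub>R (g t - h t)) \<in> borel_measurable lborel"
        unfolding set_integrable_def by (rule borel_measurable_integrable)
    qed (use int in measurable)
    ultimately show ?thesis by simp
  qed
  then have "AE x in lborel. d x = 0" by (intro AE_eq_0_if_integral_rays_eq_0 int)
  then show ?thesis by eventually_elim (auto simp: d_def)
qed

section \<open>Bilinearity and symmetry of the form\<close>

lemma gradient_is_gradient:
  assumes "f \<in> H10"
  shows "is_gradient f (gradient f)"
  using assms someI_ex[of "is_gradient f"] unfolding H10_def gradient_def by blast

lemma gradient_in_L2_unit: "f \<in> H10 \<Longrightarrow> gradient f \<in> L2_unit"
  using gradient_is_gradient is_gradient_def by blast

lemma H10_lincomb: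
  assumes "f \<in> H10" "h \<in> H10"
  shows "(\<lambda>x. a * f x + b * h x) \<in> H10"
proof -
  obtain g k where "is_gradient f g" "is_gradient h k" using assms by (auto simp: H10_def)
  then have "\<exists>g. is_gradient (\<lambda>x. a * f x + b * h x) g" by (blast intro: is_gradient_lincomb)
  then show ?thesis using assms by (simp add: H10_def)
qed

lemma set_integrable_open_unit:
  "set_integrable lborel {0..1} g \<Longrightarrow> set_integrable lborel {0<..<1} (g :: real \<Rightarrow> real)"
  by (rule set_integrable_subset) auto

text \<open>\<open>gradient\<close> picks an arbitrary representative, so it is linear only up to
  null sets; a.e. uniqueness suffices under the integral.\<close>

lemma form_lincomb_left:
  assumes "f \<in> H10" "f' \<in> H10" "h \<in> H10"
  shows "form (\<lambda>x. a * f x + b * f' x) h = a * form f h + b * form f' h"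
proof -
  let ?F = "\<lambda>x. a * f x + b * f' x"
  note L = assms[THEN gradient_in_L2_unit]
  have ae: "AE x in lborel. x \<in> {0..1} \<longrightarrow> gradient ?F x = a * gradient f x + b * gradient f' x"
    using assms by (intro is_gradient_unique_AE[of ?F] gradient_is_gradient H10_lincomb is_gradient_lincomb)
  have I: "set_integrable lborel {0<..<1} (\<lambda>x. gradient f x * gradient h x)"
    "set_integrable lborel {0<..<1} (\<lambda>x. gradient f' x * gradient h x)"
    "set_integrable lborel {0<..<1} (\<lambda>x. gradient ?F x * gradient h x)"
    using L assms by (auto intro!: set_integrable_open_unit L2_unit_mult gradient_in_L2_unit H10_lincomb)
  have "form ?F h =
      (LINT x:{0<..<1}|lborel. a * (gradient f x * gradient h x) + b * (gradient f' x * gradient h x))"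
    unfolding form_def set_lebesgue_integral_def
  proof (rule integral_cong_AE)
    show "AE x in lborel. indicat_real {0<..<1} x *\<^sub>R (gradient ?F x * gradient h x) =
        indicat_real {0<..<1} x *\<^sub>R (a * (gradient f x * gradient h x) + b * (gradient f' x * gradient h x))"
      using ae by eventually_elim (auto simp: algebra_simps split: split_indicator)
    show "(\<lambda>x. indicat_real {0<..<1} x *\<^sub>R (a * (gradient f x * gradient h x) +
        b * (gradient f' x * gradient h x))) \<in> borel_measurable lborel"
      using set_integral_add(1)[OF set_integrable_mult_right[OF I(1)] set_integrable_mult_right[OF I(2)]]
      unfolding set_integrable_def by (rule borel_measurable_integrable)
  qed (use I(3) in \<open>auto simp: set_integrable_def\<close>)
  also have "\<dots> = a * form f h + b * form f' h"
    using I by (simp add: form_def)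
  finally show ?thesis .
qed

lemma form_commute: "form f g = form g f"
  by (simp add: form_def mult.commute)

lemma form_eq_closed_interval:
  assumes "f \<in> H10"
  shows "form f f = (LINT x:{0..1}|lborel. (gradient f x)\<^sup>2)"
proof -
  have si: "set_integrable lborel {0..1} (\<lambda>x. (gradient f x)\<^sup>2)"
    using gradient_in_L2_unit[OF assms] by (auto simp: L2_unit_def)
  show ?thesis
    unfolding form_def set_lebesgue_integral_def power2_eq_square[symmetric]
  proof (rule integral_cong_AE)
    show "AE x in lborel. indicat_real {0<..<1} x *\<^sub>R (gradient f x)\<^sup>2 =
        indicat_real {0..1} x *\<^sub>R (gradient f x)\<^sup>2"
      using AE_lborel_singleton[of 0] AE_lborel_singleton[of 1]
      by eventually_elim (auto split: split_indicator)
  qed (use si set_integrable_open_unit[OF si] in \<open>auto simp: set_integrable_def\<close>)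
qed

section \<open>Cauchy-Schwarz on intervals and the resulting bound for increments\<close>

lemma square_set_integral_le:
  fixes g :: "real \<Rightarrow> real"
  assumes "a \<le> b" "set_integrable lborel {a..b} g" "set_integrable lborel {a..b} (\<lambda>t. (g t)\<^sup>2)"
  shows "(LINT t:{a..b}|lborel. g t)\<^sup>2 \<le> (b - a) * (LINT t:{a..b}|lborel. (g t)\<^sup>2)"
proof (cases "a = b")
  case True
  have "(LINT t:{a..a}|lborel. g t) = 0"
    unfolding set_lebesgue_integral_def
    by (rule integral_eq_zero_AE, rule AE_mp[OF AE_lborel_singleton[of a]]) auto
  then show ?thesis using True by simp
next
  case False
  define S where "S = (LINT t:{a..b}|lborel. g t)"
  \<comment> \<open>With \<open>m\<close> the mean of \<open>g\<close>, expanding the nonnegative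
    integral of \<open>(g t - m)\<^sup>2\<close> yields the inequality.\<close>
  define m where "m = S / (b - a)"
  have c: "set_integrable lborel {a..b} (\<lambda>_. m\<^sup>2)"
    unfolding set_integrable_def by (intro integrable_scaleR_left integrable_real_indicator) (use assms(1) in auto)
  have "0 \<le> (LINT t:{a..b}|lborel. (g t - m)\<^sup>2)"
    unfolding set_lebesgue_integral_def by (rule integral_nonneg_AE) simp
  also have "\<dots> = (LINT t:{a..b}|lborel. (g t)\<^sup>2 - 2 * m * g t + m\<^sup>2)"
    by (simp add: power2_diff algebra_simps)
  also have "\<dots> = (LINT t:{a..b}|lborel. (g t)\<^sup>2) - 2 * m * S + (LINT t:{a..b}|lborel. m\<^sup>2)"
    using assms c unfolding S_def by (simp add: set_integral_diff)
  also have "(LINT t:{a..b}|lborel. m\<^sup>2) = (b - a) * m\<^sup>2"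
    using assms(1) by (simp add: set_integral_const)
  finally have "0 \<le> (LINT t:{a..b}|lborel. (g t)\<^sup>2) - 2 * m * S + (b - a) * m\<^sup>2" .
  moreover have S: "S = m * (b - a)" using False by (simp add: m_def)
  ultimately have "m\<^sup>2 * (b - a) \<le> (LINT t:{a..b}|lborel. (g t)\<^sup>2)"
    by (simp add: power2_eq_square algebra_simps)
  then have "(b - a) * (m\<^sup>2 * (b - a)) \<le> (b - a) * (LINT t:{a..b}|lborel. (g t)\<^sup>2)"
    using assms(1) by (intro mult_left_mono) auto
  then show ?thesis
    unfolding S_def[symmetric] S by (simp add: power2_eq_square mult_ac)
qed

text \<open>The increment is an integral of the gradient, so Cauchy-Schwarz applies. The bound is
  uniform in \<open>t\<close>, and its half-open interval matches the cells of a partition, over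
  which these integrals add up.\<close>

lemma H10_increment_le:
  assumes f: "f \<in> H10" and ab: "0 \<le> a" "a \<le> t" "t \<le> b" "b \<le> 1"
  shows "(f t - f a)\<^sup>2 \<le> (b - a) * (LINT s:{a<..b}|lborel. (gradient f s)\<^sup>2)"
proof -
  let ?g = "gradient f"
  have si: "set_integrable lborel {0..1} ?g"
    using f by (intro L2_unit_integrable gradient_in_L2_unit)
  have s2: "set_integrable lborel {0..1} (\<lambda>s. (?g s)\<^sup>2)"
    using gradient_in_L2_unit[OF f] by (auto simp: L2_unit_def)
  have "f t = (LINT s:{0..t}|lborel. ?g s)" "f a = (LINT s:{0..a}|lborel. ?g s)"
    using gradient_is_gradient[OF f] ab by (auto simp: is_gradient_def)
  moreover have "(LINT s:{0..t}|lborel. ?g s) = (LINT s:{0..a} \<union> {a..t}|lborel. ?g s)"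
    using ab by (intro arg_cong[where f="\<lambda>A. set_lebesgue_integral lborel A _"]) auto
  \<comment> \<open>The two closed intervals overlap only in the null set
    \<open>{a}\<close>.\<close>
  moreover have "\<dots> = (LINT s:{0..a}|lborel. ?g s) + (LINT s:{a..t}|lborel. ?g s)"
    using AE_lborel_singleton[of a] ab
    by (intro set_integral_Un_AE set_integrable_subset[OF si]) (auto elim!: eventually_mono)
  ultimately have "f t - f a = (LINT s:{a..t}|lborel. ?g s)" by simp
  then have "(f t - f a)\<^sup>2 \<le> (t - a) * (LINT s:{a..t}|lborel. (?g s)\<^sup>2)"
    using square_set_integral_le[of a t ?g] ab set_integrable_subset[OF si, of "{a..t}"]
      set_integrable_subset[OF s2, of "{a..t}"] by auto
  also have "\<dots> \<le> (b - a) * (LINT s:{a<..b}|lborel. (?g s)\<^sup>2)"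
  proof (rule mult_mono)
    have "AE x in lborel. indicat_real {a..t} x *\<^sub>R (?g x)\<^sup>2 \<le> indicat_real {a<..b} x *\<^sub>R (?g x)\<^sup>2"
      by (rule AE_mp[OF AE_lborel_singleton[of a]]) (use ab in \<open>auto split: split_indicator\<close>)
    moreover have "set_integrable lborel {a..t} (\<lambda>s. (?g s)\<^sup>2)" "set_integrable lborel {a<..b} (\<lambda>s. (?g s)\<^sup>2)"
      using ab by (auto intro: set_integrable_subset[OF s2])
    ultimately show "(LINT s:{a..t}|lborel. (?g s)\<^sup>2) \<le> (LINT s:{a<..b}|lborel. (?g s)\<^sup>2)"
      unfolding set_lebesgue_integral_def set_integrable_def by (intro integral_mono_AE)
    show "0 \<le> (LINT s:{a..t}|lborel. (?g s)\<^sup>2)"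
      unfolding set_lebesgue_integral_def by (rule integral_nonneg_AE) simp
  qed (use ab in auto)
  finally show ?thesis .
qed

section \<open>The domain of the form\<close>

lemma C_nu_lincomb:
  assumes "f \<in> C_nu \<nu>" "h \<in> C_nu \<nu>"
  shows "(\<lambda>x. a * f x + b * h x) \<in> C_nu \<nu>"
proof -
  have aff: "\<forall>I\<in>components ({0..1} - supp \<nu>). \<exists>a b. \<forall>x\<in>I. k x = a * x + b"
    if "k \<in> C_nu \<nu>" for k
    using that unfolding C_nu_def mem_Collect_eq by (elim conjE)
  have "\<exists>p q. \<forall>x\<in>I. a * f x + b * h x = p * x + q" if I: "I \<in> components ({0..1} - supp \<nu>)" for I
  proof -
    from bspec[OF aff[OF assms(1)] I] obtain p q where pq: "\<forall>x\<in>I. f x = p * x + q"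
      by (elim exE)
    from bspec[OF aff[OF assms(2)] I] obtain p' q' where pq': "\<forall>x\<in>I. h x = p' * x + q'"
      by (elim exE)
    have "\<forall>x\<in>I. a * f x + b * h x = (a * p + b * p') * x + (a * q + b * q')"
      using pq pq' by (simp add: algebra_simps)
    then show ?thesis by (intro exI)
  qed
  then show ?thesis using assms by (auto simp: C_nu_def intro!: continuous_intros)
qed

lemma form_dom_lincomb:
  "f \<in> form_dom \<nu> \<Longrightarrow> h \<in> form_dom \<nu> \<Longrightarrow> (\<lambda>x. a * f x + b * h x) \<in> form_dom \<nu>"
  by (simp add: form_dom_def H10_lincomb C_nu_lincomb)

lemma zero_in_form_dom: "(\<lambda>_. 0) \<in> form_dom \<nu>"
proof -
  have "is_gradient (\<lambda>_. 0) (\<lambda>_. 0)"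
    by (auto simp: is_gradient_def L2_unit_def set_borel_measurable_def set_integrable_def)
  then have "(\<lambda>_. 0) \<in> H10" by (auto simp: H10_def)
  moreover have "(\<lambda>_. 0) \<in> C_nu \<nu>" by (auto simp: C_nu_def intro!: exI[of _ 0])
  ultimately show ?thesis by (simp add: form_dom_def)
qed

lemma form_dom_H10: "f \<in> form_dom \<nu> \<Longrightarrow> f \<in> H10"
  by (simp add: form_dom_def)

text \<open>The extension by zero is a function continuous on a closed interval, cut off by the
  indicator of that interval.\<close>

lemma form_dom_measurable:
  assumes "f \<in> form_dom \<nu>"
  shows "f \<in> borel_measurable borel"
proof -
  have f: "continuous_on {0..1} f" "\<forall>x. x \<notin> {0..1} \<longrightarrow> f x = 0"
    using assms unfolding form_dom_def C_nu_def by blast+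
  have "(\<lambda>x. indicat_real {0..1} x *\<^sub>R f x) \<in> borel_measurable borel"
    using f(1) by (intro borel_measurable_continuous_on_indicator) auto
  moreover have "(\<lambda>x. indicat_real {0..1} x *\<^sub>R f x) = f"
    using f(2) by (auto simp: fun_eq_iff split: split_indicator)
  ultimately show ?thesis by simp
qed

lemma form_dom_bounded:
  assumes "f \<in> form_dom \<nu>"
  obtains K where "\<And>x. \<bar>f x\<bar> \<le> K"
proof -
  have f: "continuous_on {0..1} f" "\<forall>x. x \<notin> {0..1} \<longrightarrow> f x = 0"
    using assms unfolding form_dom_def C_nu_def by blast+
  obtain K where K: "\<forall>x\<in>{0..1}. \<bar>f x\<bar> \<le> K"
    using compact_imp_bounded[OF compact_continuous_image[OF f(1)]] by (auto simp: bounded_iff)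
  then have "\<bar>f x\<bar> \<le> max K 0" for x
    using f(2) by (cases "x \<in> {0..1}") (auto simp: max.coboundedI1)
  then show thesis by (rule that)
qed

lemma form_dom_integrable_mult:
  assumes "finite_measure \<nu>" "sets \<nu> = sets borel" "f \<in> form_dom \<nu>" "h \<in> form_dom \<nu>"
  shows "integrable \<nu> (\<lambda>x. f x * h x)"
proof -
  obtain K K' where K: "\<And>x. \<bar>f x\<bar> \<le> K" "\<And>x. \<bar>h x\<bar> \<le> K'"
    using assms(3,4) form_dom_bounded by metis
  have [measurable]: "f \<in> borel_measurable \<nu>" "h \<in> borel_measurable \<nu>"
    using assms(2-4) form_dom_measurable measurable_cong_sets by blast+
  have "norm (f x * h x) \<le> K * K'" for x
    using K[of x] by (auto simp: abs_mult intro!: mult_mono)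
  then show ?thesis
    by (intro finite_measure.integrable_const_bound[OF assms(1), of _ "K * K'"]) auto
qed

section \<open>Definiteness of the form and finite sums in its first argument\<close>

lemma set_integral_mono_set_nonneg:
  fixes g :: "'a \<Rightarrow> real"
  assumes "set_integrable M B g" "A \<in> sets M" "A \<subseteq> B" "\<And>x. 0 \<le> g x"
  shows "(LINT x:A|M. g x) \<le> (LINT x:B|M. g x)"
  using assms(1) set_integrable_subset[OF assms(1-3)] assms(3,4)
  unfolding set_lebesgue_integral_def set_integrable_def
  by (intro integral_mono) (auto split: split_indicator)

text \<open>The boundary value 0 at the left end makes the form definite: the square of any nonzero
  value of \<open>f\<close> is the square of an increment from 0, which the form dominates.\<close>

lemma form_pos:
  assumes "f \<in> H10" "f \<noteq> (\<lambda>_. 0)"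
  shows "form f f > 0"
proof -
  obtain x where x: "f x \<noteq> 0" using assms(2) by auto
  have s2: "set_integrable lborel {0..1} (\<lambda>s. (gradient f s)\<^sup>2)"
    using gradient_in_L2_unit[OF assms(1)] by (auto simp: L2_unit_def)
  have f: "f 0 = 0" "x \<in> {0..1}" using assms(1) x by (auto simp: H10_def)
  have "0 < (f x)\<^sup>2" using x by simp
  also have "\<dots> \<le> (LINT s:{0<..1}|lborel. (gradient f s)\<^sup>2)"
    using H10_increment_le[OF assms(1), of 0 x 1] f by auto
  also have "\<dots> \<le> form f f"
    unfolding form_eq_closed_interval[OF assms(1)]
    by (rule set_integral_mono_set_nonneg[OF s2]) auto
  finally show ?thesis .
qed

lemma form_nonneg: "0 \<le> form f f"
  unfolding form_def set_lebesgue_integral_def by (rule integral_nonneg_AE) simp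

lemma form_zero_left: "h \<in> H10 \<Longrightarrow> form (\<lambda>_. 0) h = 0"
  using form_lincomb_left[of h h h 0 0] by simp

lemma form_dom_sum:
  "(\<And>l. l \<in> L \<Longrightarrow> F l \<in> form_dom \<nu>) \<Longrightarrow> (\<lambda>t. \<Sum>l\<in>L. F l t) \<in> form_dom \<nu>"
proof (induction L rule: infinite_finite_induct)
  case (insert l L)
  then show ?case using form_dom_lincomb[of "F l" \<nu> "\<lambda>t. \<Sum>l\<in>L. F l t" 1 1] by simp
qed (auto simp: zero_in_form_dom)

lemma form_sum_left:
  assumes "\<And>l. l \<in> L \<Longrightarrow> F l \<in> form_dom \<nu>" "h \<in> form_dom \<nu>"
  shows "form (\<lambda>t. \<Sum>l\<in>L. F l t) h = (\<Sum>l\<in>L. form (F l) h)"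
  using assms
proof (induction L rule: infinite_finite_induct)
  case (insert l L)
  then show ?case
    using form_lincomb_left[OF form_dom_H10 form_dom_H10[OF form_dom_sum] form_dom_H10,
      of "F l" \<nu> L F \<nu> h \<nu> 1 1] by simp
qed (auto simp: form_zero_left form_dom_H10)

subsection \<open>Eigenspaces\<close>

text \<open>Both sides of the eigenvalue equation are linear in the eigenfunction; the right side
  splits because products of domain functions are bounded and \<open>\<nu>\<close> is
  finite.\<close>

lemma subspace_eigenspace:
  assumes "finite_measure \<nu>" "sets \<nu> = sets borel"
  shows "fun_space.subspace (eigenspace \<nu> l)"
proof -
  have lin: "(\<lambda>x. a * f x + b * h x) \<in> eigenspace \<nu> l"
    if f: "f \<in> eigenspace \<nu> l" and h: "h \<in> eigenspace \<nu> l" for a b f h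
  proof -
    have d: "f \<in> form_dom \<nu>" "h \<in> form_dom \<nu>" using f h by (auto simp: eigenspace_def)
    have "form (\<lambda>x. a * f x + b * h x) g = l * (LINT x|\<nu>. (a * f x + b * h x) * g x)"
      if g: "g \<in> form_dom \<nu>" for g
    proof -
      have "(LINT x|\<nu>. (a * f x + b * h x) * g x) = (LINT x|\<nu>. a * (f x * g x) + b * (h x * g x))"
        by (simp add: algebra_simps)
      also have "\<dots> = a * (LINT x|\<nu>. f x * g x) + b * (LINT x|\<nu>. h x * g x)"
        using form_dom_integrable_mult[OF assms d(1) g] form_dom_integrable_mult[OF assms d(2) g] by simp
      finally show ?thesis
        using f h d g by (simp add: form_lincomb_left form_dom_H10 eigenspace_def algebra_simps)
    qed
    then show ?thesis using d by (simp add: eigenspace_def form_dom_lincomb)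
  qed
  have zero: "(\<lambda>_. 0) \<in> eigenspace \<nu> l"
    by (auto simp: eigenspace_def zero_in_form_dom form_zero_left form_dom_H10)
  show ?thesis
  proof (rule fun_space.subspaceI)
    show "0 \<in> eigenspace \<nu> l" using zero by (simp add: zero_fun_def)
    show "f + h \<in> eigenspace \<nu> l" if "f \<in> eigenspace \<nu> l" "h \<in> eigenspace \<nu> l" for f h
      using lin[OF that, of 1 1] by (simp add: plus_fun_def)
    show "(\<lambda>x. c * f x) \<in> eigenspace \<nu> l" if "f \<in> eigenspace \<nu> l" for c f
      using lin[OF that zero, of c 0] by simp
  qed
qed

text \<open>Symmetry of the form lets the same value be computed with either eigenvalue, so
  \<open>l\<close> and \<open>m\<close> times the integral coincide.\<close>

lemma eigenspace_orthogonal: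
  assumes "f \<in> eigenspace \<nu> l" "h \<in> eigenspace \<nu> m" "l \<noteq> m"
  shows "(LINT x|\<nu>. f x * h x) = 0"
proof -
  have "form f h = l * (LINT x|\<nu>. f x * h x)" "form h f = m * (LINT x|\<nu>. h x * f x)"
    using assms by (auto simp: eigenspace_def)
  then show ?thesis using assms(3) by (simp add: form_commute mult.commute)
qed

subsection \<open>Partitions and the counting function\<close>

lemma consecutive_less_imp_mono:
  fixes c :: "nat \<Rightarrow> 'a::preorder"
  assumes "\<forall>k\<in>{1..n - 1}. c k < c (k + 1)" "1 \<le> k" "k \<le> m" "m \<le> n"
  shows "c k \<le> c m"
  using assms(3,1,2,4)
proof (induction m rule: dec_induct)
  case (step m)
  then have "c m < c (m + 1)" by auto
  then have "c m \<le> c (Suc m)" by (simp add: less_imp_le)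
  moreover have "c k \<le> c m" using step by simp
  ultimately show ?case using order_trans by blast
qed simp

lemma UN_consecutive_intervals:
  fixes c :: "nat \<Rightarrow> 'a::linorder"
  assumes "1 \<le> m" "\<forall>k\<in>{1..m - 1}. c k < c (k + 1)"
  shows "(\<Union>k\<in>{1..m - 1}. {c k<..c (k + 1)}) = {c 1<..c m}"
  using assms
proof (induction m)
  case (Suc m)
  show ?case
  proof (cases "m = 0")
    case False
    then have "c 1 \<le> c m" "c m < c (Suc m)"
      using Suc.prems consecutive_less_imp_mono[of "Suc m" c 1 m] by auto
    moreover have "{1..Suc m - 1} = insert m {1..m - 1}" using False by auto
    ultimately show ?thesis using Suc False by (auto simp: not_le intro: order.strict_trans1)
  qed simp
qed simp

text \<open>Replaces the sequence of breakpoints by properties of the set of cells; the eigenvalue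
  estimates rely on these alone.\<close>

lemma nu_partitions_structure:
  assumes "P \<in> nu_partitions \<nu>"
  shows "finite P" "P \<noteq> {}" "disjoint P" "\<Union>P = {0<..1}"
    and "\<And>C. C \<in> P \<Longrightarrow> \<exists>a b. C = {a<..b} \<and> 0 \<le> a \<and> a < b \<and> b \<le> 1"
proof -
  obtain c and n :: nat where n: "n \<ge> 2" "c 1 = 0" "c n = 1"
    and c: "\<forall>k\<in>{1..n - 1}. c k < c (k + 1)"
    and P: "P = {{c k<..c (k + 1)} | k. k \<in> {1..n - 1}}"
    using assms unfolding nu_partitions_def by blast
  have P': "P = (\<lambda>k. {c k<..c (k + 1)}) ` {1..n - 1}" using P by auto
  show "finite P" "P \<noteq> {}" using n by (auto simp: P')
  show U: "\<Union>P = {0<..1}"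
    using UN_consecutive_intervals[of n c] n c by (simp add: P')
  have mono: "c k \<le> c m" if "1 \<le> k" "k \<le> m" "m \<le> n" for k m
    using consecutive_less_imp_mono[OF c that] .
  show "\<exists>a b. C = {a<..b} \<and> 0 \<le> a \<and> a < b \<and> b \<le> 1" if C: "C \<in> P" for C
  proof -
    obtain k where k: "k \<in> {1..n - 1}" "C = {c k<..c (k + 1)}" using C by (auto simp: P')
    then show ?thesis using mono[of 1 k] mono[of "k + 1" n] c n by fastforce
  qed
  have dj: "{c k<..c (k + 1)} \<inter> {c m<..c (m + 1)} = {}"
    if "k \<in> {1..n - 1}" "m \<in> {1..n - 1}" "k < m" for k m
  proof -
    have "c (k + 1) \<le> c m" using that by (intro mono) auto
    then show ?thesis by auto
  qed
  show "disjoint P"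
  proof (rule disjointI)
    fix A B assume "A \<in> P" "B \<in> P" "A \<noteq> B"
    then obtain k m where k: "k \<in> {1..n - 1}" "m \<in> {1..n - 1}" "A = {c k<..c (k + 1)}"
      "B = {c m<..c (m + 1)}" unfolding P' by blast
    with \<open>A \<noteq> B\<close> have "k \<noteq> m" by auto
    then show "A \<inter> B = {}" using dj[of k m] dj[of m k] k by (metis inf_commute linorder_neqE_nat)
  qed
qed

text \<open>Since \<open>f\<close> vanishes at the left end of a cell \<open>C\<close>, its square
  on \<open>C\<close> is at most the length of \<open>C\<close> times the energy of \<open>f\<close>
  on \<open>C\<close>. Integrating over \<open>C\<close> gives the factor
  \<open>measure \<nu> C * measure lborel C\<close>, and the energies of the disjoint cells add
  up.\<close>

lemma integral_square_le_form:
  assumes \<nu>: "finite_measure \<nu>" "sets \<nu> = sets borel"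
    and P: "P \<in> nu_partitions \<nu>"
    and f: "f \<in> form_dom \<nu>" "\<And>C. C \<in> P \<Longrightarrow> f (Inf C) = 0"
    and m: "\<And>C. C \<in> P \<Longrightarrow> measure \<nu> C * measure lborel C \<le> m"
  shows "(LINT x|\<nu>. f x * f x) \<le> m * form f f"
proof -
  interpret finite_measure \<nu> by fact
  note S = nu_partitions_structure[OF P]
  have H: "f \<in> H10" using f(1) by (rule form_dom_H10)
  define I where "I = (\<lambda>C. LINT s:C|lborel. (gradient f s)\<^sup>2)"
  have s2: "set_integrable lborel {0..1} (\<lambda>s. (gradient f s)\<^sup>2)"
    using gradient_in_L2_unit[OF H] by (auto simp: L2_unit_def)
  have I0: "0 \<le> I C" for C
    unfolding I_def set_lebesgue_integral_def by (rule integral_nonneg_AE) simp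
  have meas: "C \<in> sets borel" "C \<in> sets \<nu>" if C: "C \<in> P" for C
  proof -
    obtain a b where "C = {a<..b}" using S(5)[OF C] by blast
    then show "C \<in> sets borel" "C \<in> sets \<nu>" unfolding \<nu>(2) by simp_all
  qed
  have m0: "0 \<le> m"
  proof -
    obtain C where "C \<in> P" using S(2) by auto
    then show ?thesis
      using m by (intro order_trans[OF mult_nonneg_nonneg[OF measure_nonneg measure_nonneg]])
  qed
  have pw: "f x * f x \<le> (\<Sum>C\<in>P. indicator C x * (measure lborel C * I C))" for x
  proof (cases "x \<in> {0<..1}")
    case False
    \<comment> \<open>The point 0 lies in no cell but is a zero of \<open>f\<close> by the boundary
      condition.\<close>
    then have "f x = 0" using H by (cases "x = 0") (auto simp: H10_def)
    then show ?thesis by (auto intro!: sum_nonneg mult_nonneg_nonneg I0)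
  next
    case True
    then obtain C where C: "C \<in> P" "x \<in> C" using S(4) by blast
    obtain a b where ab: "C = {a<..b}" "0 \<le> a" "a < b" "b \<le> 1" using S(5)[OF C(1)] by blast
    have "f a = 0" using f(2)[OF C(1)] ab by simp
    then have "f x * f x \<le> indicator C x * (measure lborel C * I C)"
      using H10_increment_le[OF H, of a x b] C ab by (simp add: I_def power2_eq_square)
    also have "\<dots> \<le> (\<Sum>C\<in>P. indicator C x * (measure lborel C * I C))"
      using S(1) C(1) by (intro member_le_sum) (auto intro!: mult_nonneg_nonneg I0)
    finally show ?thesis .
  qed
  have int: "integrable \<nu> (\<lambda>x. indicator C x * (measure lborel C * I C))" if "C \<in> P" for C
    using meas[OF that] by (intro integrable_mult_left) (auto simp: less_top[symmetric])
  have "(LINT x|\<nu>. f x * f x) \<le> (LINT x|\<nu>. (\<Sum>C\<in>P. indicator C x * (measure lborel C * I C)))"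
    using pw int form_dom_integrable_mult[OF \<nu> f(1) f(1)]
    by (intro integral_mono Bochner_Integration.integrable_sum) auto
  also have "\<dots> = (\<Sum>C\<in>P. LINT x|\<nu>. indicator C x * (measure lborel C * I C))"
    using int by (rule Bochner_Integration.integral_sum)
  also have "\<dots> = (\<Sum>C\<in>P. (measure \<nu> C * measure lborel C) * I C)"
    using meas(2) sets.sets_into_space by (intro sum.cong) (auto simp: Int_absorb2)
  also have "\<dots> \<le> (\<Sum>C\<in>P. m * I C)"
    by (intro sum_mono mult_right_mono m I0)
  also have "\<dots> = m * (\<Sum>C\<in>P. I C)" by (simp add: sum_distrib_left)
  also have "(\<Sum>C\<in>P. I C) = I (\<Union>C\<in>P. C)"
    unfolding I_def
  proof (rule set_integral_finite_Union[symmetric])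
    show "disjoint_family_on (\<lambda>C. C) P" using S(3) by (simp add: disjoint_family_on_def disjoint_def)
    show "set_integrable lborel C (\<lambda>s. (gradient f s)\<^sup>2)" if "C \<in> P" for C
    proof (rule set_integrable_subset[OF s2])
      show "C \<subseteq> {0..1}" using Union_upper[OF that] unfolding S(4) by auto
    qed (use meas(1)[OF that] in simp)
  qed (use S(1) meas(1) in auto)
  also have "\<dots> \<le> form f f"
    unfolding form_eq_closed_interval[OF H] I_def
    using S(4) by (intro set_integral_mono_set_nonneg[OF s2]) auto
  finally show ?thesis using m0 by (simp add: mult_left_mono)
qed

text \<open>Gaussian elimination, by induction on the equations: each equation with a nonzero
  coefficient removes one unknown, and a trivial equation costs nothing.\<close>

lemma homogeneous_system_nontrivial_solution:
  fixes a :: "'j \<Rightarrow> 't \<Rightarrow> 'a::field"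
  assumes "finite T" "finite J" "card T < card J"
  shows "\<exists>c. (\<exists>j\<in>J. c j \<noteq> 0) \<and> (\<forall>t\<in>T. (\<Sum>j\<in>J. c j * a j t) = 0)"
  using assms
proof (induction T arbitrary: J a rule: finite_induct)
  case empty
  then have "J \<noteq> {}" by auto
  then show ?case by (intro exI[of _ "\<lambda>_. 1"]) auto
next
  case (insert t T)
  show ?case
  proof (cases "\<forall>j\<in>J. a j t = 0")
    case True
    obtain c where "\<exists>j\<in>J. c j \<noteq> 0" "\<forall>t\<in>T. (\<Sum>j\<in>J. c j * a j t) = 0"
      using insert.IH[of J a] insert.prems insert.hyps by auto
    then show ?thesis using True by (intro exI[of _ c]) auto
  next
    case False
    then obtain k where k: "k \<in> J" "a k t \<noteq> 0" by auto
    \<comment> \<open>The coefficients left after solving equation \<open>t\<close> for the unknown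
      \<open>k\<close> and substituting. Those of equation \<open>t\<close> itself become 0.\<close>
    define a' where "a' = (\<lambda>j s. a j s - a j t / a k t * a k s)"
    have "card T < card (J - {k})" using insert.prems insert.hyps k by simp
    then obtain c' where c': "\<exists>j\<in>J - {k}. c' j \<noteq> 0" "\<forall>s\<in>T. (\<Sum>j\<in>J - {k}. c' j * a' j s) = 0"
      using insert.IH[of "J - {k}" a'] insert.prems by auto
    define c where "c = c'(k := - (\<Sum>j\<in>J - {k}. c' j * (a j t / a k t)))"
    have "(\<Sum>j\<in>J. c j * a j s) = (\<Sum>j\<in>J - {k}. c' j * a' j s)" for s
    proof -
      have "(\<Sum>j\<in>J. c j * a j s) = c k * a k s + (\<Sum>j\<in>J - {k}. c j * a j s)"
        using k insert.prems by (simp add: sum.remove)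
      also have "(\<Sum>j\<in>J - {k}. c j * a j s) = (\<Sum>j\<in>J - {k}. c' j * a j s)"
        by (rule sum.cong) (auto simp: c_def)
      also have "c k * a k s = - (\<Sum>j\<in>J - {k}. c' j * (a j t / a k t) * a k s)"
        by (simp add: c_def sum_distrib_right)
      finally show ?thesis
        by (simp add: a'_def right_diff_distrib sum_subtractf mult.assoc)
    qed
    moreover have "a' j t = 0" for j using k by (simp add: a'_def)
    ultimately have "\<forall>s\<in>insert t T. (\<Sum>j\<in>J. c j * a j s) = 0" using c' by simp
    moreover have "\<exists>j\<in>J. c j \<noteq> 0" using c' by (auto simp: c_def)
    ultimately show ?thesis by blast
  qed
qed

text \<open>Stated for arbitrary finite independent families, so that it can first exclude
  infinitely many eigenvalues and infinite-dimensional eigenspaces, and then bound the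
  count.\<close>

lemma card_independent_eigenfunctions_le:
  assumes \<nu>: "finite_measure \<nu>" "sets \<nu> = sets borel"
    and P: "P \<in> nu_partitions \<nu>" "Max ((\<lambda>C. measure \<nu> C * measure lborel C) ` P) < 1 / x" "0 < x"
    and L: "finite L" "\<And>l. l \<in> L \<Longrightarrow> l \<le> x"
    and B: "\<And>l. l \<in> L \<Longrightarrow> finite (B l)" "\<And>l. l \<in> L \<Longrightarrow> B l \<subseteq> eigenspace \<nu> l"
      "\<And>l. l \<in> L \<Longrightarrow> fun_space.independent (B l)"
  shows "(\<Sum>l\<in>L. card (B l)) \<le> card P"
proof (rule ccontr)
  assume less: "\<not> ?thesis"
  note S = nu_partitions_structure[OF P(1)]
  \<comment> \<open>The left endpoints of the cells, each imposing one linear condition. The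
    unknowns are indexed by pairs of an eigenvalue and a basis function, so their number is exactly
    the sum in the claim.\<close>
  define T where "T = Inf ` P"
  have "card T \<le> card P" unfolding T_def by (rule card_image_le[OF S(1)])
  also have "\<dots> < card (Sigma L B)" using less L(1) B(1) by simp
  finally obtain c where c: "\<exists>j\<in>Sigma L B. c j \<noteq> 0"
      "\<forall>t\<in>T. (\<Sum>j\<in>Sigma L B. c j * snd j t) = 0"
    using homogeneous_system_nontrivial_solution[of T "Sigma L B" snd] S(1) L(1) B(1)
    by (auto simp: T_def)
  define F where "F = (\<lambda>l t. \<Sum>b\<in>B l. c (l, b) * b t)"
  define f where "f = (\<lambda>t. \<Sum>l\<in>L. F l t)"
  \<comment> \<open>Rewrites the pointwise sum as a sum in the function space, where closure of
    subspaces and independence apply.\<close>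
  have F_sum: "F l = (\<Sum>b\<in>B l. (\<lambda>t. c (l, b) * b t))" if "l \<in> L" for l
  proof -
    have "(\<Sum>b\<in>A. (\<lambda>t. c (l, b) * b t)) = (\<lambda>t. \<Sum>b\<in>A. c (l, b) * b t)" for A
      by (induction A rule: infinite_finite_induct) (auto simp: fun_eq_iff)
    then show ?thesis by (simp add: F_def)
  qed
  have F_eig: "F l \<in> eigenspace \<nu> l" if "l \<in> L" for l
    unfolding F_sum[OF that] using B(2)[OF that] subspace_eigenspace[OF \<nu>, of l]
    by (auto intro!: fun_space.subspace_sum fun_space.subspace_scale)
  then have F_dom: "F l \<in> form_dom \<nu>" if "l \<in> L" for l
    using that by (simp add: eigenspace_def)
  then have f_dom: "f \<in> form_dom \<nu>" unfolding f_def by (rule form_dom_sum)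
  have f_zero: "f (Inf C) = 0" if "C \<in> P" for C
  proof -
    have "f t = (\<Sum>j\<in>Sigma L B. c j * snd j t)" for t
      unfolding f_def F_def using L(1) B(1) by (subst sum.Sigma) (auto simp: split_def)
    then show ?thesis using c(2) that by (simp add: T_def)
  qed
  \<comment> \<open>Orthogonality of distinct eigenspaces removes the cross terms.\<close>
  have int_F: "(LINT x|\<nu>. F l x * f x) = (LINT x|\<nu>. F l x * F l x)" if "l \<in> L" for l
  proof -
    have "(LINT x|\<nu>. F l x * f x) = (LINT x|\<nu>. (\<Sum>k\<in>L. F l x * F k x))"
      by (simp add: f_def sum_distrib_left)
    also have "\<dots> = (\<Sum>k\<in>L. LINT x|\<nu>. F l x * F k x)"
      using that by (intro Bochner_Integration.integral_sum form_dom_integrable_mult[OF \<nu>] F_dom)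
    also have "\<dots> = (\<Sum>k\<in>L. if k = l then LINT x|\<nu>. F l x * F l x else 0)"
      using that by (intro sum.cong refl) (auto intro!: eigenspace_orthogonal F_eig)
    finally show ?thesis using that L(1) by simp
  qed
  have form_F: "form (F l) f = form (F l) (F l)" "form (F l) (F l) \<le> x * (LINT x|\<nu>. F l x * f x)"
    if "l \<in> L" for l
  proof -
    have *: "form (F l) g = l * (LINT x|\<nu>. F l x * g x)" if "g \<in> form_dom \<nu>" for g
      using F_eig[OF \<open>l \<in> L\<close>] that by (simp add: eigenspace_def)
    show "form (F l) f = form (F l) (F l)"
      using *[OF f_dom] *[OF F_dom[OF that]] int_F[OF that] by simp
    have "0 \<le> (LINT x|\<nu>. F l x * F l x)" by (rule integral_nonneg_AE) simp
    then show "form (F l) (F l) \<le> x * (LINT x|\<nu>. F l x * f x)"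
      using *[OF F_dom[OF that]] int_F[OF that] L(2)[OF that] by (simp add: mult_right_mono)
  qed
  have form_f: "form f f = (\<Sum>l\<in>L. form (F l) (F l))"
    unfolding f_def using form_sum_left[of L F \<nu> f] F_dom f_dom form_F(1)
    by (simp add: f_def)
  also have "\<dots> \<le> (\<Sum>l\<in>L. x * (LINT x|\<nu>. F l x * f x))"
    by (intro sum_mono form_F(2))
  also have "\<dots> = x * (\<Sum>l\<in>L. LINT x|\<nu>. F l x * f x)" by (simp add: sum_distrib_left)
  also have "(\<Sum>l\<in>L. LINT x|\<nu>. F l x * f x) = (LINT x|\<nu>. (\<Sum>l\<in>L. F l x * f x))"
    by (intro Bochner_Integration.integral_sum[symmetric] form_dom_integrable_mult[OF \<nu>] F_dom f_dom)
  also have "\<dots> = (LINT x|\<nu>. f x * f x)" by (simp add: f_def sum_distrib_right)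
  finally have le: "form f f \<le> x * (LINT x|\<nu>. f x * f x)" .
  \<comment> \<open>Independence turns one nonzero coefficient into a nonzero component
    \<open>F l\<close>, whose positive energy is one of the nonnegative summands of
    \<open>form f f\<close>.\<close>
  obtain l b where lb: "l \<in> L" "b \<in> B l" "c (l, b) \<noteq> 0" using c(1) by auto
  have "F l \<noteq> (\<lambda>_. 0)"
  proof
    assume "F l = (\<lambda>_. 0)"
    then have "(\<Sum>b\<in>B l. (\<lambda>t. c (l, b) * b t)) = 0"
      using F_sum[OF lb(1)] by (simp add: zero_fun_def)
    then show False
      using fun_space.independentD[OF B(3)[OF lb(1)] B(1)[OF lb(1)] order_refl _ lb(2), of "\<lambda>b. c (l, b)"] lb(3)
      by simp
  qed
  then have "0 < form (F l) (F l)" using F_dom[OF lb(1)] by (intro form_pos form_dom_H10)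
  also have "\<dots> \<le> form f f"
    unfolding form_f using lb(1) L(1) form_nonneg by (intro member_le_sum) auto
  finally have pos: "0 < form f f" .
  define m where "m = Max ((\<lambda>C. measure \<nu> C * measure lborel C) ` P)"
  have "(LINT x|\<nu>. f x * f x) \<le> m * form f f"
    using S(1) unfolding m_def
    by (intro integral_square_le_form[OF \<nu> P(1) f_dom f_zero]) auto
  \<comment> \<open>Positivity of \<open>form f f\<close> keeps the inequality strict, which
    contradicts \<open>le\<close>.\<close>
  also have "\<dots> < 1 / x * form f f" using P(2) pos unfolding m_def by (intro mult_strict_right_mono)
  finally show False using le P(3) by (simp add: field_simps)
qed

text \<open>The count can be infinite through infinitely many eigenvalues or through an eigenspace
  of infinite dimension. In either case \<open>card P + 1\<close> independent eigenfunctions would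
  exist, against the bound; otherwise the bound is applied to bases of all eigenspaces at
  once.\<close>

lemma eigenvalue_count_le_card:
  assumes \<nu>: "finite_measure \<nu>" "sets \<nu> = sets borel"
    and P: "P \<in> nu_partitions \<nu>" "Max ((\<lambda>C. measure \<nu> C * measure lborel C) ` P) < 1 / x" "0 < x"
  shows "eigenvalue_count \<nu> x \<le> enat (card P)"
proof -
  let ?E = "{l \<in> eigenvalues \<nu>. l \<le> x}"
  note bound = card_independent_eigenfunctions_le[OF \<nu> P]
  have fin: "finite ?E"
  proof (rule ccontr)
    assume "infinite ?E"
    then obtain L where L: "L \<subseteq> ?E" "finite L" "card L = Suc (card P)"
      using infinite_arbitrarily_large by blast
    then have "\<forall>l\<in>L. \<exists>f. f \<in> eigenspace \<nu> l \<and> f \<noteq> (\<lambda>_. 0)"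
      by (auto simp: eigenvalues_def)
    then obtain h where h: "\<forall>l\<in>L. h l \<in> eigenspace \<nu> l \<and> h l \<noteq> (\<lambda>_. 0)" by metis
    have "(\<Sum>l\<in>L. card {h l}) \<le> card P"
      using L h by (intro bound) (auto simp: zero_fun_def)
    then show False using L(3) by simp
  qed
  have "\<exists>B. B \<subseteq> eigenspace \<nu> l \<and> fun_space.independent B \<and> eigenspace \<nu> l \<subseteq> fun_space.span B
      \<and> card B = fun_space.dim (eigenspace \<nu> l)" for l
    by (metis fun_space.basis_exists)
  then obtain B where B: "\<And>l. B l \<subseteq> eigenspace \<nu> l" "\<And>l. fun_space.independent (B l)"
      "\<And>l. eigenspace \<nu> l \<subseteq> fun_space.span (B l)" "\<And>l. card (B l) = fun_space.dim (eigenspace \<nu> l)"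
    by metis
  have B_fin: "finite (B l)" if "l \<in> ?E" for l
  proof (rule ccontr)
    assume "infinite (B l)"
    then obtain A where A: "A \<subseteq> B l" "finite A" "card A = Suc (card P)"
      using infinite_arbitrarily_large by blast
    have "(\<Sum>k\<in>{l}. card A) \<le> card P"
      using A B that fun_space.independent_mono[OF B(2) A(1)] by (intro bound) auto
    then show False using A(3) by simp
  qed
  then have "edim (eigenspace \<nu> l) = enat (card (B l))" if "l \<in> ?E" for l
    using B(3,4) that unfolding edim_def by auto
  then have "eigenvalue_count \<nu> x = (\<Sum>l\<in>?E. enat (card (B l)))"
    using fin by (simp add: eigenvalue_count_def)
  also have "\<dots> = enat (\<Sum>l\<in>?E. card (B l))"
    using of_nat_sum[of "\<lambda>l. card (B l)" ?E, where 'a=enat] by (simp add: of_nat_eq_enat)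
  also have "\<dots> \<le> enat (card P)"
    using fin B B_fin by (subst enat_ord_simps) (intro bound, auto)
  finally show ?thesis .
qed

subsection \<open>Partitions from covers of the support\<close>

text \<open>The breakpoints are the points of \<open>F\<close> in increasing order. The last
  property, that no point of \<open>F\<close> is interior to a cell, later confines cells to single
  covering intervals.\<close>

lemma nu_partition_of_finite_set:
  assumes F: "finite F" "0 \<in> F" "1 \<in> F" "F \<subseteq> {0..1}" "\<And>p. p \<in> F \<Longrightarrow> measure \<nu> {p} = 0"
  obtains P where "P \<in> nu_partitions \<nu>" "card P < card F"
    "\<And>C. C \<in> P \<Longrightarrow> \<exists>a b. C = {a<..b} \<and> a \<in> F \<and> b \<in> F \<and> a < b \<and> F \<inter> {a<..<b} = {}"
proof -
  define xs where "xs = sorted_list_of_set F"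
  define n where "n = card F"
  \<comment> \<open>Breakpoints are numbered from 1, list entries from 0.\<close>
  define c where "c = (\<lambda>k. xs ! (k - 1))"
  have xs: "set xs = F" "length xs = n" "sorted_wrt (<) xs"
    using F(1) by (auto simp: xs_def n_def)
  have "card {0, 1::real} \<le> n" unfolding n_def using F by (intro card_mono) auto
  then have n: "n \<ge> 2" by simp
  have less: "c k < c m" if "1 \<le> k" "k < m" "m \<le> n" for k m
    unfolding c_def using that xs by (intro sorted_wrt_nth_less[OF xs(3)]) auto
  have inF: "c k \<in> F" if "k \<in> {1..n}" for k
    unfolding c_def xs(1)[symmetric] using that xs(2) by (intro nth_mem) auto
  have ex: "\<exists>k\<in>{1..n}. c k = p" if "p \<in> F" for p
  proof -
    have "p \<in> set xs" using that xs(1) by simp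
    then obtain i where "i < n" "xs ! i = p" unfolding in_set_conv_nth xs(2) by blast
    then show ?thesis by (intro bexI[of _ "i + 1"]) (auto simp: c_def)
  qed
  have F01: "0 \<le> p" "p \<le> 1" if "p \<in> F" for p using F(4) that by auto
  have c1: "c 1 = 0"
  proof -
    obtain k where k: "k \<in> {1..n}" "c k = 0" using ex F(2) by blast
    have "0 \<le> c 1" using n by (intro F01 inF) simp
    then show ?thesis using less[of 1 k] k by (cases "k = 1") auto
  qed
  have cn: "c n = 1"
  proof -
    obtain k where k: "k \<in> {1..n}" "c k = 1" using ex F(3) by blast
    have "c n \<le> 1" using n by (intro F01 inF) simp
    then show ?thesis using less[of k n] k by (cases "k = n") auto
  qed
  define P where "P = {{c k<..c (k + 1)} | k. k \<in> {1..n - 1}}"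
  show thesis
  proof (rule that)
    show "P \<in> nu_partitions \<nu>"
      unfolding nu_partitions_def mem_Collect_eq
      by (intro exI[of _ c] exI[of _ n]) (intro conjI ballI P_def n c1 cn less F(5) inF, auto)
    have "P = (\<lambda>k. {c k<..c (k + 1)}) ` {1..n - 1}" by (auto simp: P_def)
    then have "card P \<le> n - 1" using card_image_le[of "{1..n - 1}" "\<lambda>k. {c k<..c (k + 1)}"] by simp
    then show "card P < card F" using n by (simp add: n_def)
    fix C assume "C \<in> P"
    then obtain k where k: "k \<in> {1..n - 1}" "C = {c k<..c (k + 1)}" by (auto simp: P_def)
    \<comment> \<open>An interior point of \<open>F\<close> would need an index strictly between
      \<open>k\<close> and \<open>k + 1\<close>.\<close>
    have False if p: "p \<in> F" "c k < p" "p < c (k + 1)" for p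
    proof -
      obtain j where j: "j \<in> {1..n}" "c j = p" using ex p(1) by blast
      have "k \<le> n" using k by auto
      then have "\<not> j < k" "j \<noteq> k" "\<not> k + 1 < j" "j \<noteq> k + 1"
        using less[of j k] less[of "k + 1" j] p j k by auto
      then show False by simp
    qed
    then have "F \<inter> {c k<..<c (k + 1)} = {}" by auto
    moreover have "c k \<in> F" "c (k + 1) \<in> F" using k inF by auto
    moreover have "c k < c (k + 1)" using less k by auto
    ultimately show "\<exists>a b. C = {a<..b} \<and> a \<in> F \<and> b \<in> F \<and> a < b \<and> F \<inter> {a<..<b} = {}"
      using k(2) by blast
  qed
qed

text \<open>The complement of the support is the union of all open null sets, and the Lindelof
  property reduces it to a countable union.\<close>

lemma emeasure_Compl_supp:
  fixes \<nu> :: "'a::second_countable_topology measure"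
  assumes "sets \<nu> = sets borel"
  shows "emeasure \<nu> (- supp \<nu>) = 0"
proof -
  let ?U = "{U. open U \<and> emeasure \<nu> U = 0}"
  have eq: "- supp \<nu> = \<Union>?U" by (auto simp: supp_def)
  obtain V where V: "V \<subseteq> ?U" "countable V" "\<Union>V = \<Union>?U"
    using Lindelof[of ?U] by blast
  have "(\<Union>U\<in>V. U) \<in> null_sets \<nu>"
    using V(1,2) assms by (intro null_sets_UN') (auto simp: null_sets_def)
  then have "emeasure \<nu> (\<Union>U\<in>V. U) = 0" by auto
  then show ?thesis using eq V(3) by simp
qed

text \<open>A finite measure has only countably many atoms, too few to fill an interval.\<close>

lemma exists_non_atom_between:
  fixes a b :: real
  assumes "finite_measure \<nu>" "a < b"
  shows "\<exists>u. a < u \<and> u < b \<and> measure \<nu> {u} = 0"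
proof -
  have "uncountable {a<..<b}" using assms(2) by (simp add: uncountable_open_interval)
  then have "\<not> {a<..<b} \<subseteq> {u. measure \<nu> {u} \<noteq> 0}"
    using finite_measure.countable_support[OF assms(1)] countable_subset by blast
  then show ?thesis by auto
qed

text \<open>Each covering ball is slightly enlarged to an interval with \<open>\<nu>\<close>-null endpoints. A cell of the
  partition by these endpoints that is not \<open>\<nu>\<close>-null meets the support, hence lies inside an
  enlarged ball.\<close>

lemma nu_partition_of_cover:
  assumes \<nu>: "finite_measure \<nu>" "sets \<nu> = sets borel" "emeasure \<nu> (- {0<..<1}) = 0"
    and S: "finite S" "supp \<nu> \<subseteq> (\<Union>s\<in>S. cball s r)" and r: "0 < r"
  obtains P where "P \<in> nu_partitions \<nu>" "card P \<le> 2 * card S + 1"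
    "\<And>C. C \<in> P \<Longrightarrow> measure \<nu> C * measure lborel C \<le> 4 * r * measure \<nu> UNIV"
proof -
  interpret finite_measure \<nu> by fact
  \<comment> \<open>The margin between radius \<open>r\<close> and \<open>2 * r\<close> leaves room
    for a non-atom on either side, at a total width below \<open>4 * r\<close>.\<close>
  have "\<forall>s. \<exists>u. s - 2 * r < u \<and> u < s - r \<and> measure \<nu> {u} = 0"
    using r by (auto intro!: exists_non_atom_between \<nu>)
  then obtain u where u: "\<And>s. s - 2 * r < u s" "\<And>s. u s < s - r" "\<And>s. measure \<nu> {u s} = 0"
    by metis
  have "\<forall>s. \<exists>v. s + r < v \<and> v < s + 2 * r \<and> measure \<nu> {v} = 0"
    using r by (auto intro!: exists_non_atom_between \<nu>)
  then obtain v where v: "\<And>s. s + r < v s" "\<And>s. v s < s + 2 * r" "\<And>s. measure \<nu> {v s} = 0"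
    by metis
  \<comment> \<open>At most two endpoints per ball, plus 0 and 1, give \<open>2 * card S + 2\<close>
    points and hence at most \<open>2 * card S + 1\<close> cells.\<close>
  define F where "F = {0, 1} \<union> (u ` S \<union> v ` S) \<inter> {0<..<1}"
  have out: "measure \<nu> {p} = 0" if "p \<notin> {0<..<1}" for p
  proof -
    have "emeasure \<nu> {p} \<le> emeasure \<nu> (- {0<..<1})"
      by (rule emeasure_mono) (use that in \<open>simp_all add: \<nu>(2)\<close>)
    then show ?thesis using \<nu>(3) by (simp add: measure_def)
  qed
  have 01: "measure \<nu> {0} = 0" "measure \<nu> {1} = 0" by (rule out, simp)+
  have finF: "finite F" using S(1) by (auto simp: F_def)
  have "card F \<le> card {0::real, 1} + card ((u ` S \<union> v ` S) \<inter> {0<..<1})"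
    unfolding F_def by (rule card_Un_le)
  also have "card ((u ` S \<union> v ` S) \<inter> {0<..<1}) \<le> card (u ` S \<union> v ` S)"
    using S(1) by (intro card_mono) auto
  also have "\<dots> \<le> card (u ` S) + card (v ` S)" by (rule card_Un_le)
  also have "\<dots> \<le> card S + card S" by (intro add_mono card_image_le S(1))
  finally have cardF: "card F \<le> 2 * card S + 2" by simp
  obtain P where P: "P \<in> nu_partitions \<nu>" "card P < card F"
    "\<And>C. C \<in> P \<Longrightarrow> \<exists>a b. C = {a<..b} \<and> a \<in> F \<and> b \<in> F \<and> a < b \<and> F \<inter> {a<..<b} = {}"
    by (rule nu_partition_of_finite_set[of F \<nu>]) (use finF 01 u(3) v(3) in \<open>auto simp: F_def\<close>)
  show thesis
  proof (rule that[OF P(1)])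
    show "card P \<le> 2 * card S + 1" using P(2) cardF by simp
    fix C assume "C \<in> P"
    then obtain a b where ab: "C = {a<..b}" "a \<in> F" "b \<in> F" "a < b" "F \<inter> {a<..<b} = {}"
      using P(3) by blast
    have ab01: "0 \<le> a" "b \<le> 1" using ab(2,3) by (auto simp: F_def)
    show "measure \<nu> C * measure lborel C \<le> 4 * r * measure \<nu> UNIV"
    proof (cases "C \<inter> supp \<nu> = {}")
      case True
      have "- supp \<nu> \<in> sets \<nu>"
      proof -
        have "- supp \<nu> = \<Union>{U. open U \<and> emeasure \<nu> U = 0}" by (auto simp: supp_def)
        then have "open (- supp \<nu>)" by auto
        then show ?thesis using \<nu>(2) by auto
      qed
      then have "emeasure \<nu> C \<le> emeasure \<nu> (- supp \<nu>)"
        using True by (intro emeasure_mono) auto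
      then have "measure \<nu> C = 0" using emeasure_Compl_supp[OF \<nu>(2)] by (simp add: measure_def)
      then show ?thesis using r by simp
    next
      case False
      then obtain p s where p: "p \<in> C" "s \<in> S" "p \<in> cball s r" using S(2) by blast
      then have p': "a < p" "p \<le> b" "s - r \<le> p" "p \<le> s + r"
        using ab(1) by (auto simp: dist_real_def)
      \<comment> \<open>\<open>u s\<close> lies strictly left of \<open>p\<close>. Either it is a
        breakpoint, hence not inside the cell, or it was discarded for lying outside the open unit
        interval, hence is at most 0. The argument for \<open>v s\<close> is the mirror
        image.\<close>
      have "u s \<le> a"
      proof (cases "u s \<in> F")
        case True
        then have "u s \<notin> {a<..<b}" using ab(5) by blast
        then show ?thesis using u(2)[of s] p' by auto
      next
        case False
        then have "u s \<notin> {0<..<1}" using p(2) by (auto simp: F_def)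
        then show ?thesis using u(2)[of s] p' ab01 by auto
      qed
      moreover have "b \<le> v s"
      proof (cases "v s \<in> F")
        case True
        then have "v s \<notin> {a<..<b}" using ab(5) by blast
        then show ?thesis using v(1)[of s] p' by auto
      next
        case False
        then have "v s \<notin> {0<..<1}" using p(2) by (auto simp: F_def)
        then show ?thesis using v(1)[of s] p' ab01 by auto
      qed
      ultimately have "measure lborel C \<le> 4 * r" using u(1)[of s] v(2)[of s] ab(1,4) by simp
      moreover have "measure \<nu> C \<le> measure \<nu> UNIV"
        using \<nu>(2) sets_eq_imp_space_eq[OF \<nu>(2)] by (metis bounded_measure space_borel)
      ultimately have "measure \<nu> C * measure lborel C \<le> measure \<nu> UNIV * (4 * r)"
        by (intro mult_mono) auto
      then show ?thesis by (simp add: mult_ac)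
    qed
  qed
qed

text \<open>The factor 5 exceeds the 4 of the cell bound, which makes the inequality strict as
  \<open>partition_count\<close> demands.\<close>

lemma partition_count_le_covering_number:
  assumes \<nu>: "finite_measure \<nu>" "sets \<nu> = sets borel" "emeasure \<nu> (- {0<..<1}) = 0"
    "measure \<nu> UNIV > 0"
    and r: "0 < r"
  shows "partition_count \<nu> (1 / (5 * measure \<nu> UNIV * r)) \<le> 2 * covering_number (supp \<nu>) r + 1"
proof (cases "\<exists>S. finite S \<and> supp \<nu> \<subseteq> (\<Union>s\<in>S. cball s r)")
  case False
  \<comment> \<open>Without a finite cover the infimum is taken over the empty set and equals
    \<open>\<infinity>\<close>.\<close>
  then have "{enat (card S) |S. finite S \<and> supp \<nu> \<subseteq> (\<Union>s\<in>S. cball s r)} = {}" by blast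
  then have "covering_number (supp \<nu>) r = \<infinity>"
    by (simp only: covering_number_def Inf_enat_def) simp
  moreover have "2 * (\<infinity>::enat) = \<infinity>" by (simp add: numeral_eq_enat)
  ultimately show ?thesis by simp
next
  case True
  let ?X = "{enat (card S) |S. finite S \<and> supp \<nu> \<subseteq> (\<Union>s\<in>S. cball s r)}"
  have "?X \<noteq> {}" using True by blast
  then have "Inf ?X \<in> ?X" unfolding Inf_enat_def by (auto intro: LeastI)
  then obtain S where S: "finite S" "supp \<nu> \<subseteq> (\<Union>s\<in>S. cball s r)"
    "covering_number (supp \<nu>) r = enat (card S)"
    unfolding covering_number_def by auto
  obtain P where P: "P \<in> nu_partitions \<nu>" "card P \<le> 2 * card S + 1"
    "\<And>C. C \<in> P \<Longrightarrow> measure \<nu> C * measure lborel C \<le> 4 * r * measure \<nu> UNIV"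
    using nu_partition_of_cover[OF \<nu>(1-3) S(1,2) r] by blast
  have "finite P" "P \<noteq> {}" using nu_partitions_structure(1,2)[OF P(1)] .
  then have "Max ((\<lambda>C. measure \<nu> C * measure lborel C) ` P) \<le> 4 * r * measure \<nu> UNIV"
    using P(3) by (subst Max_le_iff) auto
  also have "\<dots> < 1 / (1 / (5 * measure \<nu> UNIV * r))" using \<nu>(4) r by simp
  finally have "partition_count \<nu> (1 / (5 * measure \<nu> UNIV * r)) \<le> enat (card P)"
    unfolding partition_count_def using P(1) by (intro Inf_lower) blast
  also have "\<dots> \<le> enat (2 * card S + 1)" using P(2) by simp
  also have "\<dots> = 2 * covering_number (supp \<nu>) r + 1"
    by (simp add: S(3) numeral_eq_enat one_enat_def)
  finally show ?thesis .
qed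

subsection \<open>Comparison of the exponents\<close>

lemma elog_mono: "m \<le> n \<Longrightarrow> elog m \<le> elog n"
  by (cases m; cases n) (auto simp: elog_def)

text \<open>Excludes the value \<open>-\<infinity>\<close> of \<open>elog\<close> at 0 and later
  allows \<open>2 * n + 1\<close> to be bounded by \<open>3 * n\<close>.\<close>

lemma covering_number_pos:
  assumes "A \<noteq> {}"
  shows "covering_number A r \<noteq> 0"
proof
  let ?X = "{enat (card S) |S. finite S \<and> A \<subseteq> (\<Union>c\<in>S. cball c r)}"
  assume 0: "covering_number A r = 0"
  then have "?X \<noteq> {}" by (auto simp: covering_number_def Inf_enat_def split: if_splits)
  then have "Inf ?X \<in> ?X" unfolding Inf_enat_def by (auto intro: LeastI)
  then obtain S where "finite S" "A \<subseteq> (\<Union>c\<in>S. cball c r)" "enat (card S) = 0"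
    using 0 unfolding covering_number_def by auto
  then show False using assms by (auto simp: zero_enat_def)
qed

text \<open>Substituting \<open>x = 1 / (5 * M * r)\<close> changes the denominator from
  \<open>- ln r\<close> to \<open>- k - ln r\<close>, and the factor 3 adds \<open>ln 3\<close> to
  the numerator; both constants become negligible as \<open>r\<close> tends to 0.\<close>

lemma lower_h_le_lower_minkowski_dim:
  assumes \<nu>: "finite_measure \<nu>" "sets \<nu> = sets borel" "emeasure \<nu> (- {0<..<1}) = 0"
    "emeasure \<nu> {0<..<1} \<noteq> 0"
  shows "lower_h \<nu> \<le> lower_minkowski_dim (supp \<nu>)"
proof (rule ccontr)
  interpret finite_measure \<nu> by fact
  define M where "M = measure \<nu> UNIV"
  define N where "N = covering_number (supp \<nu>)"
  define p where "p = partition_count \<nu>"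
  define k where "k = ln (5 * M)"
  have "emeasure \<nu> {0<..<1} \<le> emeasure \<nu> UNIV"
    using \<nu>(2) by (intro emeasure_mono) auto
  then have E: "emeasure \<nu> UNIV \<noteq> 0" using \<nu>(4) by auto
  then have M: "M > 0" by (simp add: M_def emeasure_eq_measure zero_less_measure_iff)
  have "supp \<nu> \<noteq> {}" using emeasure_Compl_supp[OF \<nu>(2)] E by auto
  then have N0: "N r \<noteq> 0" for r unfolding N_def by (rule covering_number_pos)
  assume "\<not> ?thesis"
  then have "lower_minkowski_dim (supp \<nu>) < lower_h \<nu>" by simp
  then obtain y where y: "lower_minkowski_dim (supp \<nu>) < ereal y" "ereal y < lower_h \<nu>"
    using ereal_dense2 by blast
  \<comment> \<open>The gap between \<open>y\<close> and \<open>y'\<close> absorbs the error from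
    these constants.\<close>
  obtain y' where y': "ereal y < ereal y'" "ereal y' < lower_h \<nu>"
    using y(2) ereal_dense2 by blast
  have "LIM r at_right 0. - k - ln r :> at_top"
    using filterlim_tendsto_add_at_top[OF tendsto_const[of "- k"]
      filterlim_uminus_at_top_at_bot[THEN filterlim_compose, OF ln_at_0]] by simp
  \<comment> \<open>The expression is \<open>(ln 3 + y * (- ln r)) / (- k - ln r)\<close> rewritten
    as \<open>y\<close> plus a vanishing error.\<close>
  then have lim: "((\<lambda>r. y + (ln 3 + y * k) / (- k - ln r)) \<longlongrightarrow> y + 0) (at_right 0)"
    by (intro tendsto_intros tendsto_divide_0[OF tendsto_const] filterlim_at_top_imp_at_infinity)
  have "LIM r at_right 0. 5 * M * r :> at_right 0"
    using M by (auto simp: filterlim_at eventually_at_right_less intro!: tendsto_eq_intros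
      eventually_at_rightI[of 0 1])
  then have "LIM r at_right 0. inverse (5 * M * r) :> at_top"
    using filterlim_compose[OF filterlim_inverse_at_top_right] by blast
  then have top: "LIM r at_right 0. 1 / (5 * M * r) :> at_top"
    by (simp add: inverse_eq_divide)
  have "\<forall>\<^sub>F x in at_top. ereal y' < elog (p x) / ereal (ln x)"
    using less_LiminfD[OF y'(2)[unfolded lower_h_def lower_exponent_def]] by (simp add: p_def)
  then have "\<forall>\<^sub>F r in at_right 0. ereal y' < elog (p (1 / (5 * M * r))) / ereal (ln (1 / (5 * M * r)))"
    using top by (rule eventually_compose_filterlim)
  moreover have "\<forall>\<^sub>F r in at_right 0. 1 / (5 * M * r) > 1"
    using top by (simp add: filterlim_at_top_dense)
  moreover have "\<forall>\<^sub>F r in at_right 0. y + (ln 3 + y * k) / (- k - ln r) < y'"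
    using order_tendstoD(2)[OF lim, of y'] y'(1) by simp
  moreover have "\<forall>\<^sub>F r in at_right 0. (0::real) < r \<and> r < 1"
    by (rule eventually_at_rightI[of 0 1]) auto
  ultimately have "\<forall>\<^sub>F r in at_right 0. ereal y \<le> elog (N r) / ereal (- ln r)"
  proof eventually_elim
    case (elim r)
    show ?case
    proof (rule ccontr)
      assume "\<not> ?case"
      then have lt: "elog (N r) / ereal (- ln r) < ereal y" by simp
      have lr: "- ln r > 0" using elim by simp
      obtain n where n: "N r = enat n"
        using lt lr by (cases "N r") (auto simp: elog_def)
      have "n \<noteq> 0" using N0[of r] n by (auto simp: zero_enat_def)
      then have ln_n: "ln (real n) < y * (- ln r)"
        using lt lr n by (simp add: elog_def field_simps)
      have eq: "ln (1 / (5 * M * r)) = - k - ln r"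
        using M elim by (simp add: k_def ln_div ln_mult)
      have pos: "- k - ln r > 0" using elim(2) eq ln_gt_zero[OF elim(2)] by simp
      have "p (1 / (5 * M * r)) \<le> 2 * N r + 1"
        unfolding p_def N_def M_def
        by (rule partition_count_le_covering_number) (use \<nu> M elim in \<open>auto simp: M_def\<close>)
      also have "\<dots> = enat (2 * n + 1)" by (simp add: n numeral_eq_enat one_enat_def)
      also have "\<dots> \<le> enat (3 * n)" using \<open>n \<noteq> 0\<close> by simp
      finally have "elog (p (1 / (5 * M * r))) \<le> elog (enat (3 * n))" by (rule elog_mono)
      also have "\<dots> = ereal (ln 3 + ln (real n))" using \<open>n \<noteq> 0\<close> by (simp add: elog_def ln_mult)
      finally have "elog (p (1 / (5 * M * r))) / ereal (- k - ln r) \<le>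
          ereal (ln 3 + ln (real n)) / ereal (- k - ln r)"
        using pos by (intro ereal_divide_right_mono) auto
      also have "\<dots> \<le> ereal ((ln 3 + y * (- ln r)) / (- k - ln r))"
        using pos ln_n by (auto intro!: divide_right_mono)
      also have "(ln 3 + y * (- ln r)) / (- k - ln r) = y + (ln 3 + y * k) / (- k - ln r)"
        using pos by (simp add: field_simps)
      also have "ereal \<dots> < ereal y'" using elim(3) by simp
      finally show False using elim(1) eq by simp
    qed
  qed
  then have "ereal y \<le> lower_minkowski_dim (supp \<nu>)"
    unfolding lower_minkowski_dim_def N_def by (rule Liminf_bounded)
  then show False using y(1) by simp
qed

lemma lower_s_le_lower_h:
  assumes "finite_measure \<nu>" "sets \<nu> = sets borel"
  shows "lower_s \<nu> \<le> lower_h \<nu>"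
  unfolding lower_s_def lower_h_def lower_exponent_def
proof (rule Liminf_mono)
  show "\<forall>\<^sub>F x in at_top. elog (eigenvalue_count \<nu> x) / ereal (ln x)
      \<le> elog (partition_count \<nu> x) / ereal (ln x)"
    \<comment> \<open>For \<open>x > 1\<close> the denominator \<open>ln x\<close> is positive, so
      dividing preserves the order.\<close>
    using eventually_gt_at_top[of 1]
  proof eventually_elim
    case (elim x)
    have "eigenvalue_count \<nu> x \<le> partition_count \<nu> x"
      unfolding partition_count_def
    proof (rule Inf_greatest)
      fix m assume "m \<in> {enat (card P) |P. P \<in> nu_partitions \<nu> \<and>
        Max ((\<lambda>C. measure \<nu> C * measure lborel C) ` P) < 1 / x}"
      then show "eigenvalue_count \<nu> x \<le> m"
        using eigenvalue_count_le_card[OF assms] elim by auto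
    qed
    then show ?case
      using ln_gt_zero[OF elim] by (intro ereal_divide_right_mono elog_mono) auto
  qed
qed

theorem proposition1p10:
  fixes \<nu> :: "real measure"
  assumes "finite_measure \<nu>"
    and "sets \<nu> = sets borel"
    and "emeasure \<nu> (- {0<..<1}) = 0"
    and "emeasure \<nu> {0<..<1} \<noteq> 0"
  shows "lower_s \<nu> \<le> lower_h \<nu> \<and> lower_h \<nu> \<le> lower_minkowski_dim (supp \<nu>)"
  using lower_s_le_lower_h lower_h_le_lower_minkowski_dim assms by blast

end
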